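(* Let $C$ be a proper convex subset of $\mathbb R^m$, $m\in\mathbb N$, let $F\in\mathcal E_C$ be a proper exposed face of $C$, let $N=N_C(F)$, and let $d:=\dim(N)$. Then the following statements are equivalent. (1) $N$ has $d$ linearly independent exposed rays which are normal cones of $C$ (i.e. belong to $\mathcal N_C$). (2) There exist $d$ mutually distinct coatoms of $\mathcal E_C$ whose intersection is $F$ and whose normal cones are linearly independent exposed rays of $N$.
   Context: $\mathbb R^m$ carries the standard inner product $\langle\cdot,\cdot\rangle$. The relative interior of a convex set is its interior in its affine hull. For a convex set $C\subset\mathbb R^m$ the normal cone of $C$ at $x\in C$ is $N_C(x):=\{u\in\mathbb R^m\mid \forall y\in C:\ \langle u,y-x\rangle\le 0\}$. For a non-empty convex subset $F\subset C$, $N_C(F):=N_C(x)$ for any relative interior point $x$ of $F$ (well-defined), and $N_C(\emptyset):=\mathbb R^m$. $\mathcal N_C$ denotes the set of normal cones of $C$ at points of $C$ together with $N_C(\emptyset)=\mathbb R^m$. An exposed face of a convex set is either the empty set or the set of minimizers of a linear form on it (the zero form is allowed, so the whole set is an exposed face). $\mathcal E_C$ is the set of exposed faces of $C$ ordered by inclusion. A proper exposed face of $C$ is an $F\in\mathcal E_C$ with $F\ne\emptyset$ and $F\ne C$. A proper convex subset of $\mathbb R^m$ is a convex subset of $\mathbb R^m$ with interior points which has a proper exposed face. A coatom of $\mathcal E_C$ is an inclusion-maximal element of $\mathcal E_C\setminus\{C\}$. A ray is a set $\{\alpha u\mid\alpha\ge0\}$ with $u\neq0$; an exposed ray of a convex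 cone is an exposed face of it which is a ray. Rays are linearly independent if vectors spanning them are. *)

theory Defs
  imports "HOL-Analysis.Analysis"
begin

text \<open>
  Exposed faces are expressed by the library predicate \<^term>\<open>(exposed_face_of)\<close>.  For convex sets
  it agrees with the definition through minimizers of linear forms: see
  \<open>exposed_face_of_iff_minimizers\<close> below.
\<close>

definition normal_cone :: "'a::euclidean_space set \<Rightarrow> 'a \<Rightarrow> 'a set" where
  "normal_cone C x = {u. \<forall>y\<in>C. u \<bullet> (y - x) \<le> 0}"

text \<open>
  The choice of the relative interior point is immaterial, see \<open>face_normal_cone_eq\<close> below.
\<close>

definition face_normal_cone :: "'a::euclidean_space set \<Rightarrow> 'a set \<Rightarrow> 'a set" where
  "face_normal_cone C F =
    (if F = {} then UNIV else normal_cone C (SOME x. x \<in> rel_interior F))"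

definition normal_cones :: "'a::euclidean_space set \<Rightarrow> 'a set set" where
  "normal_cones C = insert UNIV (normal_cone C ` C)"

definition proper_exposed_face_of :: "'a::euclidean_space set \<Rightarrow> 'a set \<Rightarrow> bool" where
  "proper_exposed_face_of F C \<longleftrightarrow> F exposed_face_of C \<and> F \<noteq> {} \<and> F \<noteq> C"

definition proper_convex :: "'a::euclidean_space set \<Rightarrow> bool" where
  "proper_convex C \<longleftrightarrow>
    convex C \<and> interior C \<noteq> {} \<and> (\<exists>F. proper_exposed_face_of F C)"

definition exposed_face_coatom :: "'a::euclidean_space set \<Rightarrow> 'a set \<Rightarrow> bool" where
  "exposed_face_coatom G C \<longleftrightarrow>
    G exposed_face_of C \<and> G \<noteq> C \<and>
    (\<forall>H. H exposed_face_of C \<and> H \<noteq> C \<and> G \<subseteq> H \<longrightarrow> H = G)"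

definition ray_spanned_by :: "'a::euclidean_space \<Rightarrow> 'a set" where
  "ray_spanned_by u = {\<alpha> *\<^sub>R u | \<alpha>. 0 \<le> \<alpha>}"

definition is_ray :: "'a::euclidean_space set \<Rightarrow> bool" where
  "is_ray R \<longleftrightarrow> (\<exists>u. u \<noteq> 0 \<and> R = ray_spanned_by u)"

definition exposed_ray_of :: "'a::euclidean_space set \<Rightarrow> 'a set \<Rightarrow> bool" where
  "exposed_ray_of R K \<longleftrightarrow> R exposed_face_of K \<and> is_ray R"

text \<open>
  Linear independence is that of a family: \<^const>\<open>independent\<close> is a predicate on sets of vectors,
  so injectivity excludes repeated members.
\<close>

definition independent_rays :: "'i set \<Rightarrow> ('i \<Rightarrow> 'a::euclidean_space set) \<Rightarrow> bool" where
  "independent_rays I R \<longleftrightarrow>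
    (\<exists>u. (\<forall>i\<in>I. u i \<noteq> 0 \<and> R i = ray_spanned_by (u i)) \<and>
         inj_on u I \<and> independent (u ` I))"

lemma exposed_face_of_iff_minimizers:
  fixes C F :: "'a::euclidean_space set"
  assumes "convex C"
  shows "F exposed_face_of C \<longleftrightarrow>
    F = {} \<or> (\<exists>a. F = {x\<in>C. \<forall>y\<in>C. a \<bullet> x \<le> a \<bullet> y})"
proof
  assume "F exposed_face_of C"
  then obtain a b where sub: "C \<subseteq> {x. a \<bullet> x \<le> b}" and F: "F = C \<inter> {x. a \<bullet> x = b}"
    unfolding exposed_face_of_def by blast
  show "F = {} \<or> (\<exists>a. F = {x\<in>C. \<forall>y\<in>C. a \<bullet> x \<le> a \<bullet> y})"
  proof (cases "F = {}")
    case False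
    then obtain z where z: "z \<in> C" "a \<bullet> z = b" using F by blast
    have "F = {x\<in>C. \<forall>y\<in>C. (-a) \<bullet> x \<le> (-a) \<bullet> y}"
    proof -
      have "a \<bullet> x = b \<longleftrightarrow> (\<forall>y\<in>C. (-a) \<bullet> x \<le> (-a) \<bullet> y)" if "x \<in> C" for x
      proof
        assume "a \<bullet> x = b"
        then show "\<forall>y\<in>C. (-a) \<bullet> x \<le> (-a) \<bullet> y" using sub by auto
      next
        assume "\<forall>y\<in>C. (-a) \<bullet> x \<le> (-a) \<bullet> y"
        then have "b \<le> a \<bullet> x" using z by force
        moreover have "a \<bullet> x \<le> b" using sub that by blast
        ultimately show "a \<bullet> x = b" by simp
      qed
      then show ?thesis unfolding F by blast
    qed
    then show ?thesis by blast
  qed simp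
next
  assume "F = {} \<or> (\<exists>a. F = {x\<in>C. \<forall>y\<in>C. a \<bullet> x \<le> a \<bullet> y})"
  moreover have "F exposed_face_of C"
    if ne: "F \<noteq> {}" and F: "F = {x\<in>C. \<forall>y\<in>C. a \<bullet> x \<le> a \<bullet> y}" for a
  proof -
    obtain z where z: "z \<in> C" "\<forall>y\<in>C. a \<bullet> z \<le> a \<bullet> y" using ne F by blast
    have eq: "F = C \<inter> {x. a \<bullet> x = a \<bullet> z}"
    proof -
      have "(\<forall>y\<in>C. a \<bullet> x \<le> a \<bullet> y) \<longleftrightarrow> a \<bullet> x = a \<bullet> z" if "x \<in> C" for x
        using z that by (metis order_antisym)
      then show ?thesis unfolding F by blast
    qed
    have "C \<inter> {x. a \<bullet> x = a \<bullet> z} exposed_face_of C"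
      using z by (intro exposed_face_of_Int_supporting_hyperplane_ge[OF assms]) auto
    then show ?thesis using eq by simp
  qed
  ultimately show "F exposed_face_of C"
    by (cases "F = {}") auto
qed

lemma normal_cone_rel_interior_subset:
  fixes C F :: "'a::euclidean_space set"
  assumes "convex F" "F \<subseteq> C" "x \<in> rel_interior F" "y \<in> rel_interior F"
  shows "normal_cone C x \<subseteq> normal_cone C y"
proof
  fix u assume u: "u \<in> normal_cone C x"
  have y: "y \<in> affine hull F"
    by (rule hull_inc[OF subsetD[OF rel_interior_subset assms(4)]])
  obtain m where m: "m > 1" "\<And>e. e > 1 \<Longrightarrow> e \<le> m \<Longrightarrow> (1 - e) *\<^sub>R y + e *\<^sub>R x \<in> F"
    using convex_rel_interior_if[OF assms(1,3)] y by blast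
  have "u \<bullet> (((1 - m) *\<^sub>R y + m *\<^sub>R x) - x) \<le> 0"
    using u subsetD[OF assms(2) m(2)[OF m(1) order_refl]] unfolding normal_cone_def by blast
  then have "(m - 1) * (u \<bullet> (x - y)) \<le> 0"
    by (simp add: algebra_simps inner_simps)
  then have xy: "u \<bullet> (x - y) \<le> 0"
    using m(1) by (simp add: mult_le_0_iff)
  have "u \<bullet> (z - y) \<le> 0" if "z \<in> C" for z
  proof -
    have "u \<bullet> (z - x) \<le> 0" using u that unfolding normal_cone_def by simp
    then show ?thesis
      using xy by (simp add: inner_diff_right)
  qed
  then show "u \<in> normal_cone C y"
    unfolding normal_cone_def by blast
qed

lemma face_normal_cone_eq:
  fixes C F :: "'a::euclidean_space set"
  assumes "convex F" "F \<subseteq> C" "x \<in> rel_interior F"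
  shows "face_normal_cone C F = normal_cone C x"
proof -
  have "F \<noteq> {}" using assms(3) by auto
  moreover have "(SOME x. x \<in> rel_interior F) \<in> rel_interior F"
    using assms(3) by (rule someI)
  ultimately show ?thesis
    using normal_cone_rel_interior_subset[OF assms(1,2)] assms(3)
    unfolding face_normal_cone_def by (simp add: subset_antisym)
qed

end

theory Submission
  imports Defs
begin

text \<open>
  One direction is immediate, since the normal cone of a face belongs to \<^const>\<open>normal_cones\<close>.

  For the other, let \<open>u\<close> span a ray that is the normal cone of \<open>C\<close> at some \<open>x \<in> C\<close>, and let \<open>G\<close>
  be the set of points of \<open>C\<close> at which \<open>u\<close> is maximal.  Any exposed face through \<open>x\<close> is cut out by
  a functional normal to \<open>C\<close> at \<open>x\<close>, hence by a nonnegative multiple of \<open>u\<close>: it is \<open>G\<close> or \<open>C\<close>.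
  So \<open>G\<close> is a coatom, and its normal cone is the ray again, because moving from \<open>x\<close> to a relative
  interior point of \<open>G\<close> can only shrink the normal cone while \<open>u\<close> remains normal on all of \<open>G\<close>
  (\<open>face_normal_cone_of_ray\<close>, \<open>coatom_of_ray\<close>).  Given \<open>d = dim N\<close> independent rays of this kind in
  \<open>N\<close>, each of these coatoms contains \<open>F\<close>, since every \<open>u \<in> N\<close> is maximal on \<open>F\<close>.  Their
  intersection is no larger: the spanning vectors form a basis of \<open>span N\<close>, a functional
  exposing \<open>F\<close> lies in \<open>N\<close>, and so it is constant on the intersection
  (\<open>Inter_support_faces_eq\<close>).  The coefficients in this basis may be negative, as only constancy
  is needed.
\<close>

text \<open>
  The set of maximizers of \<open>u\<close> over \<open>C\<close>.  Written with normal cones, it lets an inclusion between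
  normal cones at two points be read directly as a statement about the faces through them.
\<close>

definition support_face :: "'a::euclidean_space set \<Rightarrow> 'a \<Rightarrow> 'a set" where
  "support_face C u = {y\<in>C. u \<in> normal_cone C y}"

lemma support_face_eq_hyperplane:
  assumes "x \<in> C" "u \<in> normal_cone C x"
  shows "support_face C u = C \<inter> {y. u \<bullet> y = u \<bullet> x}"
  using assms unfolding support_face_def normal_cone_def
  by (fastforce simp: inner_diff_right)

lemma support_face_exposed:
  assumes "convex C" "x \<in> C" "u \<in> normal_cone C x"
  shows "support_face C u exposed_face_of C"
  unfolding support_face_eq_hyperplane[OF assms(2,3)]
  using assms(3) by (intro exposed_face_of_Int_supporting_hyperplane_le[OF assms(1)])
    (auto simp: normal_cone_def inner_diff_right)

lemma exposed_face_eq_support_face: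
  assumes "H exposed_face_of C" "x \<in> H"
  obtains a where "a \<in> normal_cone C x" "H = support_face C a"
proof -
  obtain a b where sub: "C \<subseteq> {x. a \<bullet> x \<le> b}" and H: "H = C \<inter> {x. a \<bullet> x = b}"
    using assms(1) unfolding exposed_face_of_def by blast
  then have "a \<in> normal_cone C x"
    using assms(2) by (auto simp: normal_cone_def inner_diff_right)
  moreover have "H = support_face C a"
    using support_face_eq_hyperplane[of x C a] calculation assms(2) H by auto
  ultimately show thesis using that by blast
qed

lemma support_face_ne_of_interior:
  assumes "interior C \<noteq> {}" "u \<noteq> 0"
  shows "support_face C u \<noteq> C"
proof
  assume eq: "support_face C u = C"
  obtain x e where x: "ball x e \<subseteq> C" "e > 0"
    using assms(1) by (meson ex_in_conv mem_interior)
  define y where "y = x + (e / (2 * norm u)) *\<^sub>R u"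
  have "y \<in> C" using x assms(2) by (auto simp: y_def dist_norm)
  moreover have "x \<in> support_face C u" using eq x by auto
  ultimately have "u \<bullet> (y - x) \<le> 0"
    by (auto simp: support_face_def normal_cone_def)
  then show False
    using x(2) assms(2) by (simp add: y_def mult_le_0_iff divide_le_0_iff flip: not_less)
qed

lemma normal_cone_scale:
  assumes "u \<in> normal_cone C x" "0 \<le> \<alpha>"
  shows "\<alpha> *\<^sub>R u \<in> normal_cone C x"
  using assms by (auto simp: normal_cone_def mult_le_0_iff)

lemma support_face_scale:
  assumes "0 < \<alpha>"
  shows "support_face C (\<alpha> *\<^sub>R u) = support_face C u"
  using assms by (auto simp: support_face_def normal_cone_def mult_le_0_iff)

text \<open>
  The segment from \<open>x\<close> to \<open>y\<close> can be prolonged inside \<open>F\<close> beyond the relative interior point \<open>y\<close>,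
  so a functional maximal at \<open>y\<close> cannot drop from \<open>y\<close> to \<open>x\<close>, and is maximal at \<open>x\<close> too.
\<close>

lemma normal_cone_rel_interior_le:
  fixes C F :: "'a::euclidean_space set"
  assumes "convex F" "F \<subseteq> C" "y \<in> rel_interior F" "x \<in> F"
  shows "normal_cone C y \<subseteq> normal_cone C x"
proof
  fix u assume u: "u \<in> normal_cone C y"
  obtain m where m: "m > 1" "\<And>e. e > 1 \<Longrightarrow> e \<le> m \<Longrightarrow> (1 - e) *\<^sub>R x + e *\<^sub>R y \<in> F"
    using convex_rel_interior_if[OF assms(1,3)] hull_inc[OF assms(4)] by blast
  have "u \<bullet> (((1 - m) *\<^sub>R x + m *\<^sub>R y) - y) \<le> 0"
    using u assms(2) m unfolding normal_cone_def by blast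
  then have "(m - 1) * (u \<bullet> (y - x)) \<le> 0"
    by (simp add: algebra_simps inner_simps)
  then have "u \<bullet> (y - x) \<le> 0"
    using m(1) by (simp add: mult_le_0_iff)
  with u show "u \<in> normal_cone C x"
    unfolding normal_cone_def by (fastforce simp: inner_diff_right)
qed

lemma face_normal_cone_obtain:
  fixes C F :: "'a::euclidean_space set"
  assumes "convex F" "F \<subseteq> C" "F \<noteq> {}"
  obtains y where "y \<in> rel_interior F" "y \<in> F" "face_normal_cone C F = normal_cone C y"
  using assms face_normal_cone_eq rel_interior_eq_empty rel_interior_subset
  by (metis all_not_in_conv subsetD)

lemma face_normal_cone_in_normal_cones:
  fixes C F :: "'a::euclidean_space set"
  assumes "convex F" "F \<subseteq> C"
  shows "face_normal_cone C F \<in> normal_cones C"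
proof (cases "F = {}")
  case True
  then show ?thesis by (simp add: face_normal_cone_def normal_cones_def)
next
  case False
  then obtain y where "y \<in> F" "face_normal_cone C F = normal_cone C y"
    using face_normal_cone_obtain[OF assms] by blast
  then show ?thesis using assms(2) by (auto simp: normal_cones_def)
qed

text \<open>
  The empty set contributes the whole space to \<^const>\<open>normal_cones\<close>, but a ray omits the
  negatives of its nonzero points.
\<close>

lemma ray_normal_cone_at_point:
  assumes "ray_spanned_by u \<in> normal_cones C" "u \<noteq> 0"
  obtains x where "x \<in> C" "normal_cone C x = ray_spanned_by u"
proof -
  have "ray_spanned_by u \<noteq> UNIV"
  proof
    assume "ray_spanned_by u = UNIV"
    then have "- u \<in> ray_spanned_by u" by simp
    then obtain \<alpha> where a: "0 \<le> \<alpha>" "- u = \<alpha> *\<^sub>R u" by (auto simp: ray_spanned_by_def)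
    then have "(\<alpha> + 1) *\<^sub>R u = 0" by (simp add: scaleR_left_distrib flip: a(2))
    then show False using a(1) assms(2) by simp
  qed
  then show thesis using assms(1) that by (auto simp: normal_cones_def)
qed

lemma ray_spanned_by_self: "u \<in> ray_spanned_by u"
  by (auto simp: ray_spanned_by_def intro: exI[of _ 1])

text \<open>
  The point \<open>x\<close> lies in the face but perhaps on its relative boundary.  The normal cone at a
  relative interior point is contained in the ray at \<open>x\<close>, and it still contains \<open>u\<close>.
\<close>

lemma face_normal_cone_of_ray:
  fixes C :: "'a::euclidean_space set"
  assumes "convex C" "x \<in> C" "normal_cone C x = ray_spanned_by u"
  shows "face_normal_cone C (support_face C u) = ray_spanned_by u"
proof -
  let ?G = "support_face C u"
  have u: "u \<in> normal_cone C x" using assms(3) ray_spanned_by_self by blast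
  have xG: "x \<in> ?G" using assms(2) u by (simp add: support_face_def)
  have G: "convex ?G" "?G \<subseteq> C"
    using support_face_exposed[OF assms(1,2) u]
    by (auto simp: exposed_face_of_def face_of_def)
  obtain y where y: "y \<in> rel_interior ?G" "y \<in> ?G" "face_normal_cone C ?G = normal_cone C y"
    using face_normal_cone_obtain[OF G] xG by blast
  have "normal_cone C y \<subseteq> ray_spanned_by u"
    using normal_cone_rel_interior_le[OF G y(1) xG] assms(3) by simp
  moreover have "ray_spanned_by u \<subseteq> normal_cone C y"
    using y(2) normal_cone_scale by (auto simp: support_face_def ray_spanned_by_def)
  ultimately show ?thesis using y(3) by simp
qed

text \<open>
  A larger exposed face contains \<open>x\<close>, so the functional exposing it is normal at \<open>x\<close> and hence a
  nonnegative multiple of \<open>u\<close>.  A positive multiple gives the same face, the zero multiple gives \<open>C\<close>.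
\<close>

lemma coatom_of_ray:
  fixes C :: "'a::euclidean_space set"
  assumes "convex C" "interior C \<noteq> {}" "u \<noteq> 0" "x \<in> C" "normal_cone C x = ray_spanned_by u"
  shows "exposed_face_coatom (support_face C u) C"
proof -
  have u: "u \<in> normal_cone C x" using assms(5) ray_spanned_by_self by blast
  have xG: "x \<in> support_face C u" using assms(4) u by (simp add: support_face_def)
  have "H = support_face C u"
    if H: "H exposed_face_of C" "H \<noteq> C" "support_face C u \<subseteq> H" for H
  proof -
    obtain a where a: "a \<in> normal_cone C x" "H = support_face C a"
      using exposed_face_eq_support_face[OF H(1)] xG H(3) by blast
    then obtain \<alpha> where \<alpha>: "0 \<le> \<alpha>" "a = \<alpha> *\<^sub>R u"
      using assms(5) by (auto simp: ray_spanned_by_def)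
    have "\<alpha> \<noteq> 0"
      using H(2) a(2) \<alpha>(2) by (auto simp: support_face_def normal_cone_def)
    then show ?thesis using a(2) \<alpha> support_face_scale[of \<alpha> C u] by simp
  qed
  then show ?thesis
    using support_face_exposed[OF assms(1,4) u] support_face_ne_of_interior[OF assms(2,3)]
    by (auto simp: exposed_face_coatom_def)
qed

text \<open>
  On the intersection every functional in \<open>span B\<close> takes the value that it takes at \<open>x\<close>, and a
  functional exposing \<open>F\<close> is among these.  Conversely a normal at the relative interior point
  \<open>x\<close> is normal at all points of \<open>F\<close>.
\<close>

lemma Inter_support_faces_eq:
  fixes C F :: "'a::euclidean_space set"
  assumes "F exposed_face_of C" "x \<in> rel_interior F"
    and "B \<noteq> {}" "B \<subseteq> normal_cone C x" "normal_cone C x \<subseteq> span B"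
  shows "(\<Inter>u\<in>B. support_face C u) = F"
proof
  have F: "convex F" "F \<subseteq> C" using assms(1) by (auto simp: exposed_face_of_def face_of_def)
  have x: "x \<in> F" "x \<in> C" using assms(2) F(2) rel_interior_subset by blast+
  show "F \<subseteq> (\<Inter>u\<in>B. support_face C u)"
    using normal_cone_rel_interior_le[OF F assms(2)] assms(4) F(2)
    by (fastforce simp: support_face_def)
  obtain v where v: "v \<in> normal_cone C x" "F = support_face C v"
    using exposed_face_eq_support_face[OF assms(1) x(1)] .
  show "(\<Inter>u\<in>B. support_face C u) \<subseteq> F"
  proof
    fix y assume y: "y \<in> (\<Inter>u\<in>B. support_face C u)"
    have "u \<bullet> (y - x) = 0" if "u \<in> B" for u
      using y that support_face_eq_hyperplane[OF x(2)] assms(4)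
      by (fastforce simp: inner_diff_right)
    then have "orthogonal (y - x) u" if "u \<in> B" for u
      using that by (simp add: orthogonal_def inner_commute)
    then have "orthogonal (y - x) v"
      using orthogonal_to_span assms(5) v(1) by blast
    then have "v \<bullet> y = v \<bullet> x"
      by (simp add: orthogonal_def inner_diff_right inner_commute)
    moreover have "y \<in> C" using y assms(3) by (auto simp: support_face_def)
    ultimately show "y \<in> F"
      using support_face_eq_hyperplane[OF x(2) v(1)] v(2) by simp
  qed
qed

lemma inj_on_rays_of_independent:
  assumes "independent (u ` I)" "inj_on u I"
  shows "inj_on (\<lambda>i. ray_spanned_by (u i)) I"
proof (rule inj_onI, rule ccontr)
  fix i j assume ij: "i \<in> I" "j \<in> I" "ray_spanned_by (u i) = ray_spanned_by (u j)" "i \<noteq> j"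
  then have "u i \<in> ray_spanned_by (u j)" using ray_spanned_by_self by blast
  then have "u i \<in> span {u j}" by (auto simp: ray_spanned_by_def span_singleton)
  moreover have "{u j} \<subseteq> u ` I - {u i}" using ij assms(2) by (auto dest: inj_onD)
  ultimately have "u i \<in> span (u ` I - {u i})" using span_mono by blast
  then show False using assms(1) ij(1) by (auto simp: dependent_def)
qed

theorem theorem4p1:
  fixes C F N :: "(real ^ 'm) set" and d :: nat
  assumes "proper_convex C"
    and "proper_exposed_face_of F C"
    and "N = face_normal_cone C F"
    and "d = dim N"
  shows "(\<exists>R :: nat \<Rightarrow> (real ^ 'm) set.
            (\<forall>i<d. exposed_ray_of (R i) N \<and> R i \<in> normal_cones C) \<and>
            independent_rays {..<d} R)
     \<longleftrightarrow>
         (\<exists>G :: nat \<Rightarrow> (real ^ 'm) set.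
            inj_on G {..<d} \<and>
            (\<forall>i<d. exposed_face_coatom (G i) C) \<and>
            (\<Inter>i<d. G i) = F \<and>
            (\<forall>i<d. exposed_ray_of (face_normal_cone C (G i)) N) \<and>
            independent_rays {..<d} (\<lambda>i. face_normal_cone C (G i)))"
    (is "?rays \<longleftrightarrow> ?coatoms")
proof
  assume ?coatoms
  then obtain G where G: "\<forall>i<d. exposed_face_coatom (G i) C"
      "\<forall>i<d. exposed_ray_of (face_normal_cone C (G i)) N"
      "independent_rays {..<d} (\<lambda>i. face_normal_cone C (G i))"
    by blast
  have "face_normal_cone C (G i) \<in> normal_cones C" if "i < d" for i
    using G(1) that
    by (intro face_normal_cone_in_normal_cones)
      (auto simp: exposed_face_coatom_def exposed_face_of_def face_of_def)
  then show ?rays using G(2,3) by (intro exI[of _ "\<lambda>i. face_normal_cone C (G i)"]) simp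
next
  assume ?rays
  then obtain R where R: "\<forall>i<d. exposed_ray_of (R i) N \<and> R i \<in> normal_cones C"
    and "independent_rays {..<d} R" by blast
  then obtain u where u: "\<forall>i<d. u i \<noteq> 0 \<and> R i = ray_spanned_by (u i)"
    and inj: "inj_on u {..<d}" and ind: "independent (u ` {..<d})"
    by (auto simp: independent_rays_def)
  have C: "convex C" "interior C \<noteq> {}" using assms(1) by (auto simp: proper_convex_def)
  have F: "F exposed_face_of C" "F \<noteq> {}" "F \<noteq> C"
    using assms(2) by (auto simp: proper_exposed_face_of_def)
  obtain x where x: "x \<in> rel_interior F" "x \<in> F" "N = normal_cone C x"
    using face_normal_cone_obtain[of F C] F assms(3)
    by (auto simp: exposed_face_of_def face_of_def)
  define G where "G i = support_face C (u i)" for i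
  have ray: "face_normal_cone C (G i) = R i \<and> exposed_face_coatom (G i) C" if "i < d" for i
  proof -
    obtain z where "z \<in> C" "normal_cone C z = ray_spanned_by (u i)"
      using ray_normal_cone_at_point[of "u i" C] R u \<open>i < d\<close> by metis
    then show ?thesis
      using face_normal_cone_of_ray coatom_of_ray C u \<open>i < d\<close> unfolding G_def by metis
  qed
  have sub: "u ` {..<d} \<subseteq> N"
  proof
    fix w assume "w \<in> u ` {..<d}"
    then obtain i where "i < d" "w = u i" by auto
    then show "w \<in> N"
      using R u ray_spanned_by_self
      by (fastforce simp: exposed_ray_of_def exposed_face_of_def face_of_def)
  qed
  have span: "N \<subseteq> span (u ` {..<d})"
    using card_ge_dim_independent[OF sub ind] assms(4) card_image[OF inj] by simp
  \<comment> \<open>A face other than \<open>C\<close> is exposed by a nonzero normal, so the intersection over \<open>i < d\<close> is not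
    an intersection over the empty family.\<close>
  have "d \<noteq> 0"
  proof
    assume "d = 0"
    obtain v where v: "v \<in> N" "F = support_face C v"
      using exposed_face_eq_support_face[OF F(1) x(2)] x(3) by metis
    then have "v = 0" using span \<open>d = 0\<close> by auto
    then show False using v(2) F(3) by (auto simp: support_face_def normal_cone_def)
  qed
  then have "(\<Inter>w\<in>u ` {..<d}. support_face C w) = F"
    using sub span x by (intro Inter_support_faces_eq[OF F(1) x(1)]) auto
  then have Int: "(\<Inter>i<d. G i) = F" by (simp add: G_def)
  have "inj_on (\<lambda>i. face_normal_cone C (G i)) {..<d}"
    using inj_on_rays_of_independent[OF ind inj] ray u by (simp add: inj_on_def)
  then have "inj_on G {..<d}" by (auto simp: inj_on_def)
  moreover have "independent_rays {..<d} (\<lambda>i. face_normal_cone C (G i))"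
    using u inj ind ray unfolding independent_rays_def by (intro exI[of _ u]) auto
  ultimately show ?coatoms using Int ray R by (intro exI[of _ G]) auto
qed

end
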